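(* For every fixed $\varepsilon>0$ and all sufficiently large $n$, there exists an $n$-vertex graph $G$ with $\alpha(G)\leq 2$ which does not contain an odd connected pairing of size at least $\varepsilon n$.
   Context: $\alpha(G)$ denotes the independence number. An odd connected pairing of size $s$ in a graph $G$ is a set $\{(u_1,v_1),\dots,(u_s,v_s)\}$ of $s$ ordered pairs, where $u_1,v_1,\dots,u_s,v_s\in V(G)$ are pairwise distinct, such that for all $i\neq j$ at least one of $\{u_i,u_j\}$, $\{v_i,v_j\}$ is an edge of $G$. *)

theory Defs
  imports Complex_Main
begin

definition simple_graph :: "'a set \<Rightarrow> ('a \<Rightarrow> 'a \<Rightarrow> bool) \<Rightarrow> bool" where
  "simple_graph V E \<longleftrightarrow> (\<forall>x y. E x y \<longrightarrow> x \<in> V \<and> y \<in> V) \<and>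
      (\<forall>x y. E x y \<longrightarrow> E y x) \<and> (\<forall>x. \<not> E x x)"

definition independent_set :: "'a set \<Rightarrow> ('a \<Rightarrow> 'a \<Rightarrow> bool) \<Rightarrow> 'a set \<Rightarrow> bool" where
  "independent_set V E S \<longleftrightarrow> S \<subseteq> V \<and> (\<forall>x\<in>S. \<forall>y\<in>S. \<not> E x y)"

definition independence_number :: "'a set \<Rightarrow> ('a \<Rightarrow> 'a \<Rightarrow> bool) \<Rightarrow> nat" where
  "independence_number V E = Max (card ` {S. independent_set V E S})"

definition odd_connected_pairing ::
  "'a set \<Rightarrow> ('a \<Rightarrow> 'a \<Rightarrow> bool) \<Rightarrow> nat \<Rightarrow> (nat \<Rightarrow> 'a) \<Rightarrow> (nat \<Rightarrow> 'a) \<Rightarrow> bool" where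
  "odd_connected_pairing V E s u v \<longleftrightarrow>
     u ` {..<s} \<subseteq> V \<and> v ` {..<s} \<subseteq> V \<and>
     inj_on u {..<s} \<and> inj_on v {..<s} \<and> u ` {..<s} \<inter> v ` {..<s} = {} \<and>
     (\<forall>i<s. \<forall>j<s. i \<noteq> j \<longrightarrow> E (u i) (u j) \<or> E (v i) (v j))"

end

theory Submission
  imports Defs "HOL-Library.FuncSet" "HOL-Real_Asymp.Real_Asymp"
begin

text \<open>
The complement of G has to be a triangle-free graph H such that every injection between
vertex sets of size at least \<open>\<epsilon> n\<close> maps some edge of H to an edge of H.
Call relations P, R on \<open>{0..<g}\<close> clashing if every injection between large subsets
maps some P-pair to an R-pair; this is symmetric in P and R. The key step (sparsification)
blows up P and R to \<open>k\<close> vertices and replaces R by a random graph S of density about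
\<open>log k / k\<close> inside its blow-up, with the edges in triangles deleted. Then S still clashes with
the blow-up of P, even after removing from the latter all pairs with a common S-neighbour:
an injection yields \<open>c k\<^sup>2\<close> candidate pairs, so the expected number of clashes beats the
\<open>k^k\<close> injections.

Sparsify three times, swapping the roles after each step. Starting from inequality against
inequality on a constant number of points one gets a graph \<open>\<Delta>\<close> clashing with a relation D of pairs
without a common \<open>\<Delta>\<close>-neighbour; then a triangle-free graph B inside the blow-up of D clashing with a
relation Q, which consists of the pairs in the blow-up of \<open>\<Delta>\<close> without a common B-neighbour; finally a
triangle-free graph F inside the blow-up of Q clashing with the blow-up of B. Take for H the union of
F and the blow-up of B. A triangle with two edges in B would contradict the choice of Q, and one with
two edges in F would project to a path of two \<open>\<Delta>\<close>-edges between the ends of a D-pair.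
\<close>

section \<open>Counting functions\<close>

text \<open>Greedy choice. The maps \<open>a\<close> and \<open>b\<close> give every point
  out-degree at most two, so on average the in-degree within \<open>H\<close> is at most two, and
  some \<open>v\<close> has at most two preimages. Putting \<open>v\<close> into \<open>J\<close>
  costs at most five points: \<open>v\<close>, its two images and its preimages. The induction
  handles the rest.\<close>

lemma ex_large_subset_avoiding:
  fixes a b :: "'i \<Rightarrow> 'i"
  assumes "finite H" and "\<And>t. t \<in> H \<Longrightarrow> a t \<noteq> t \<and> b t \<noteq> t"
  shows "\<exists>J\<subseteq>H. card H \<le> 5 * card J \<and> (\<forall>t\<in>J. a t \<notin> J \<and> b t \<notin> J)"
  using assms
proof (induction H rule: finite_psubset_induct)
  case (psubset H)
  show ?case
  proof (cases "H = {}")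
    case True
    then show ?thesis by simp
  next
    case False
    have fib: "(\<Sum>v\<in>H. card {t\<in>H. h t = v}) \<le> card H" for h :: "'i \<Rightarrow> 'i"
    proof -
      have "(\<Sum>v\<in>H. card {t\<in>H. h t = v}) = card (\<Union>v\<in>H. {t\<in>H. h t = v})"
        using psubset.hyps by (subst card_UN_disjoint) auto
      also have "\<dots> \<le> card H"
        using psubset.hyps by (intro card_mono) auto
      finally show ?thesis .
    qed
    have "\<exists>v\<in>H. card {t\<in>H. a t = v} + card {t\<in>H. b t = v} \<le> 2"
    proof (rule ccontr)
      assume "\<not> ?thesis"
      then have "(\<Sum>v\<in>H. card {t\<in>H. a t = v} + card {t\<in>H. b t = v}) \<ge> (\<Sum>v\<in>H. 3)"
        by (intro sum_mono) force
      moreover have "card H > 0" using False psubset.hyps by (simp add: card_gt_0_iff)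
      ultimately show False using fib[of a] fib[of b] by (simp add: sum.distrib)
    qed
    then obtain v where v: "v \<in> H" "card {t\<in>H. a t = v} + card {t\<in>H. b t = v} \<le> 2" by blast
    define N where "N = {v, a v, b v} \<union> ({t\<in>H. a t = v} \<union> {t\<in>H. b t = v})"
    have "card N \<le> card {v, a v, b v} + card ({t\<in>H. a t = v} \<union> {t\<in>H. b t = v})"
      unfolding N_def by (rule card_Un_le)
    also have "\<dots> \<le> 3 + 2"
      using v(2) card_Un_le[of "{t\<in>H. a t = v}" "{t\<in>H. b t = v}"]
      by (intro add_mono) (auto simp: card_insert_if)
    finally have N5: "card N \<le> 5" by simp
    have finN: "finite N" using psubset.hyps by (auto simp: N_def)
    have "H - N \<subset> H" using v(1) by (auto simp: N_def)
    then obtain J where J: "J \<subseteq> H - N" "card (H - N) \<le> 5 * card J"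
        "\<forall>t\<in>J. a t \<notin> J \<and> b t \<notin> J"
      using psubset.IH[of "H - N"] psubset.prems by auto
    have finJ: "finite J" using J(1) psubset.hyps by (meson finite_Diff finite_subset)
    have "v \<notin> J" using J(1) by (auto simp: N_def)
    then have "card (insert v J) = Suc (card J)" using finJ by simp
    moreover have "card H \<le> card (H - N) + card N"
      using diff_card_le_card_Diff[OF finN, of H] by linarith
    ultimately have "card H \<le> 5 * card (insert v J)" using J(2) N5 by linarith
    moreover have "\<forall>t\<in>insert v J. a t \<notin> insert v J \<and> b t \<notin> insert v J"
      using J(1,3) v(1) psubset.prems by (auto simp: N_def)
    ultimately show ?thesis using J(1) v(1) by (intro exI[of _ "insert v J"]) auto
  qed
qed

text \<open>An exponential moment bound with weight 1/2 per hit. A function with few hits has weight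
  at least \<open>exp (- (c / 4 * card I))\<close>, while the total weight factorises over
  \<open>I\<close> into powers of \<open>card X - card G / 2\<close>, which is at most
  \<open>card X * exp (- (c / 2))\<close>.\<close>

lemma card_PiE_few_hits:
  fixes X :: "'e set" and c :: real
  assumes "finite I" "finite X" "G \<subseteq> X" "0 \<le> c" "c * card X \<le> card G"
  shows "real (card {f \<in> I \<rightarrow>\<^sub>E X. real (card {t\<in>I. f t \<in> G}) \<le> c / 4 * card I})
           \<le> real (card X) ^ card I * exp (- (c / 4 * card I))"
proof -
  let ?B = "{f \<in> I \<rightarrow>\<^sub>E X. real (card {t\<in>I. f t \<in> G}) \<le> c / 4 * card I}"
  let ?w = "\<lambda>e. if e \<in> G then 1 / 2 else (1::real)"
  have finB: "finite (I \<rightarrow>\<^sub>E X)" using assms by (intro finite_PiE) auto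
  have wf: "(\<Prod>t\<in>I. ?w (f t)) = (1 / 2) ^ card {t\<in>I. f t \<in> G}" for f :: "'a \<Rightarrow> 'e"
    using assms(1) by (simp add: prod.If_cases Int_def)
  have low: "exp (- (c / 4 * card I)) \<le> (\<Prod>t\<in>I. ?w (f t))" if "f \<in> ?B" for f
  proof -
    let ?h = "card {t\<in>I. f t \<in> G}"
    have "exp (- (c / 4 * card I)) \<le> exp (- real ?h)" using that by simp
    also have "\<dots> = exp (- 1) ^ ?h" by (simp add: exp_of_nat_mult[symmetric])
    also have "\<dots> \<le> (1 / 2) ^ ?h"
      using exp_ge_add_one_self[of 1] by (intro power_mono) (auto simp: exp_minus field_simps)
    finally show ?thesis by (simp only: wf)
  qed
  have "card ?B * exp (- (c / 4 * card I)) = (\<Sum>f\<in>?B. exp (- (c / 4 * card I)))" by simp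
  also have "\<dots> \<le> (\<Sum>f\<in>?B. \<Prod>t\<in>I. ?w (f t))" by (intro sum_mono low)
  also have "\<dots> \<le> (\<Sum>f\<in>I \<rightarrow>\<^sub>E X. \<Prod>t\<in>I. ?w (f t))"
    using finB by (intro sum_mono2) (auto intro!: prod_nonneg)
  also have "\<dots> = (\<Prod>t\<in>I. \<Sum>e\<in>X. ?w e)"
    using assms by (subst prod_sum_PiE) auto
  also have "\<dots> = (\<Sum>e\<in>X. ?w e) ^ card I" by simp
  also have "(\<Sum>e\<in>X. ?w e) = real (card X) - card G / 2"
  proof -
    have "(\<Sum>e\<in>X. ?w e) = (\<Sum>e\<in>X. 1 - (if e \<in> G then 1 / 2 else 0))" by (intro sum.cong) auto
    also have "\<dots> = real (card X) - (\<Sum>e\<in>X. if e \<in> G then 1 / 2 else 0)"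
      by (simp add: sum_subtractf)
    also have "(\<Sum>e\<in>X. if e \<in> G then 1 / 2 else (0::real)) = card G / 2"
      using assms(2,3) by (simp add: sum.If_cases Int_absorb1)
    finally show ?thesis .
  qed
  also have "(real (card X) - card G / 2) ^ card I \<le> (card X * exp (- (c / 2))) ^ card I"
  proof (intro power_mono)
    have "real (card X) - card G / 2 \<le> card X * (1 - c / 2)"
      using assms(5) by (simp add: algebra_simps)
    also have "\<dots> \<le> card X * exp (- (c / 2))"
      using exp_ge_add_one_self[of "- (c / 2)"] by (intro mult_left_mono) auto
    finally show "real (card X) - card G / 2 \<le> card X * exp (- (c / 2))" .
    show "0 \<le> real (card X) - card G / 2"
      using card_mono[OF assms(2,3)] by simp
  qed
  also have "\<dots> = real (card X) ^ card I * exp (- (c / 4 * card I)) * exp (- (c / 4 * card I))"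
    by (simp add: power_mult_distrib exp_of_nat_mult[symmetric] exp_add[symmetric])
  finally show ?thesis by simp
qed

text \<open>Reveal \<open>f\<close> outside \<open>J\<close> first. This fixes the set
  \<open>V h\<close>, after which each coordinate in \<open>J\<close> has at most \<open>b\<close>
  choices. Letting \<open>V\<close> depend on the revealed part is what makes the bound usable for
  events in which one value is constrained by the others.\<close>

lemma card_PiE_restricted:
  fixes X :: "'e set"
  assumes "finite I" "finite X" "J \<subseteq> I"
    and V: "\<And>h. h \<in> (I - J) \<rightarrow>\<^sub>E X \<Longrightarrow> P h \<Longrightarrow> finite (V h) \<and> card (V h) \<le> b"
  shows "card {f \<in> I \<rightarrow>\<^sub>E X. P (restrict f (I - J)) \<and> (\<forall>t\<in>J. f t \<in> V (restrict f (I - J)))}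
           \<le> card X ^ (card I - card J) * b ^ card J"
proof -
  let ?F = "{f \<in> I \<rightarrow>\<^sub>E X. P (restrict f (I - J)) \<and> (\<forall>t\<in>J. f t \<in> V (restrict f (I - J)))}"
  let ?H = "{h \<in> (I - J) \<rightarrow>\<^sub>E X. P h}"
  let ?g = "\<lambda>f. (restrict f (I - J), restrict f J)"
  have finJ: "finite J" using assms finite_subset by blast
  have finH: "finite ((I - J) \<rightarrow>\<^sub>E X)" using assms by (intro finite_PiE) auto
  have inj: "inj_on ?g ?F"
  proof (rule inj_onI)
    fix f f' assume f: "f \<in> ?F" "f' \<in> ?F" and eq: "?g f = ?g f'"
    have "f t = f' t" if "t \<in> I" for t
    proof (cases "t \<in> J")
      case True
      with eq show ?thesis by (metis Pair_inject restrict_apply')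
    next
      case False
      with eq that show ?thesis by (metis DiffI Pair_inject restrict_apply')
    qed
    moreover have "f \<in> I \<rightarrow>\<^sub>E X" "f' \<in> I \<rightarrow>\<^sub>E X" using f by auto
    ultimately show "f = f'" by (intro PiE_ext) auto
  qed
  have sub: "?g ` ?F \<subseteq> (SIGMA h:?H. J \<rightarrow>\<^sub>E V h)"
    using assms(3) by (auto simp: PiE_def Pi_def)
  have fin: "finite (SIGMA h:?H. J \<rightarrow>\<^sub>E V h)"
    using finH V finJ by (intro finite_SigmaI finite_PiE) auto
  have "card ?F = card (?g ` ?F)" using inj by (simp add: card_image)
  also have "\<dots> \<le> card (SIGMA h:?H. J \<rightarrow>\<^sub>E V h)" using fin sub by (rule card_mono)
  also have "\<dots> = (\<Sum>h\<in>?H. card (J \<rightarrow>\<^sub>E V h))"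
    using finH V finJ by (intro card_SigmaI) (auto intro!: finite_PiE)
  also have "\<dots> \<le> (\<Sum>h\<in>?H. b ^ card J)"
    using V finJ by (intro sum_mono) (auto simp: card_PiE intro!: power_mono)
  also have "\<dots> = card ?H * b ^ card J" by simp
  also have "\<dots> \<le> card ((I - J) \<rightarrow>\<^sub>E X) * b ^ card J"
    using finH by (intro mult_right_mono card_mono) auto
  also have "card ((I - J) \<rightarrow>\<^sub>E X) = card X ^ (card I - card J)"
    using assms finJ by (simp add: card_PiE card_Diff_subset)
  finally show ?thesis .
qed

section \<open>Random edge sequences whose hits lie on two-edge paths\<close>

text \<open>Drawing ordered pairs keeps the sample space a plain product; \<open>ends\<close>
  forgets the order. A drawn loop becomes a singleton.\<close>

definition ends :: "'v \<times> 'v \<Rightarrow> 'v set" where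
  "ends e = {fst e, snd e}"

definition touching_pairs :: "('i \<Rightarrow> 'v \<times> 'v) \<Rightarrow> 'i set \<Rightarrow> ('i \<times> 'i) set" where
  "touching_pairs f I = {(s, s') \<in> I \<times> I. s \<noteq> s' \<and> ends (f s) \<inter> ends (f s') \<noteq> {}}"

definition two_paths :: "('i \<Rightarrow> 'v \<times> 'v) \<Rightarrow> 'i set \<Rightarrow> ('v \<times> 'v) set" where
  "two_paths f I = {(p, q). p \<noteq> q \<and>
     (\<exists>s\<in>I. \<exists>s'\<in>I. \<exists>w. w \<noteq> p \<and> w \<noteq> q \<and> ends (f s) = {p, w} \<and> ends (f s') = {w, q})}"

lemma finite_ends [simp]: "finite (ends e)"
  by (simp add: ends_def)

lemma card_ends: "card (ends e) \<le> 2"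
  by (simp add: ends_def card_insert_if)

lemma finite_touching_pairs: "finite I \<Longrightarrow> finite (touching_pairs f I)"
  by (rule finite_subset[of _ "I \<times> I"]) (auto simp: touching_pairs_def)

text \<open>The two edges of a path touch at its midpoint, and its outer vertices are one end of
  each edge. So a touching pair accounts for at most 2 * 2 ordered pairs.\<close>

lemma card_two_paths:
  assumes "finite I"
  shows "finite (two_paths f I)" "card (two_paths f I) \<le> 4 * card (touching_pairs f I)"
proof -
  let ?U = "\<Union>z\<in>touching_pairs f I. ends (f (fst z)) \<times> ends (f (snd z))"
  have fin: "finite (touching_pairs f I)" by (rule finite_touching_pairs[OF assms])
  have sub: "two_paths f I \<subseteq> ?U"
  proof
    fix z assume "z \<in> two_paths f I"
    then obtain p q s s' w where z: "z = (p, q)" "p \<noteq> q" "s \<in> I" "s' \<in> I" "w \<noteq> p" "w \<noteq> q"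
        "ends (f s) = {p, w}" "ends (f s') = {w, q}"
      by (auto simp: two_paths_def)
    then have "s \<noteq> s'" by auto
    with z have "(s, s') \<in> touching_pairs f I" by (auto simp: touching_pairs_def)
    with z show "z \<in> ?U" by (intro UN_I[of "(s, s')"]) auto
  qed
  have finU: "finite ?U" using fin by (intro finite_UN_I) simp_all
  show "finite (two_paths f I)" using sub finU by (rule finite_subset)
  have "card (two_paths f I) \<le> card ?U" using finU sub by (rule card_mono)
  also have "\<dots> \<le> (\<Sum>z\<in>touching_pairs f I. card (ends (f (fst z)) \<times> ends (f (snd z))))"
    using fin by (rule card_UN_le)
  also have "\<dots> \<le> (\<Sum>z\<in>touching_pairs f I. 2 * 2)"
    unfolding card_cartesian_product by (intro sum_mono mult_le_mono card_ends)
  finally show "card (two_paths f I) \<le> 4 * card (touching_pairs f I)" by simp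
qed

text \<open>Once all values except the one at \<open>s'\<close> are known, that value needs a
  coordinate among the at most two ends of \<open>f s\<close>. This is the restricted count with
  \<open>J = {s'}\<close> and a trivial \<open>P\<close>.\<close>

lemma card_touching:
  assumes "finite I" "finite V" "s \<in> I" "s' \<in> I" "s \<noteq> s'"
  shows "card {f \<in> I \<rightarrow>\<^sub>E V \<times> V. ends (f s) \<inter> ends (f s') \<noteq> {}}
           \<le> (card V ^ 2) ^ (card I - 1) * (4 * card V)"
proof -
  let ?W = "\<lambda>h. {e \<in> V \<times> V. ends (h s) \<inter> ends e \<noteq> {}}"
  have W: "finite (?W h) \<and> card (?W h) \<le> 4 * card V" for h
  proof -
    have "?W h \<subseteq> ends (h s) \<times> V \<union> V \<times> ends (h s)" by (auto simp: ends_def)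
    then have "card (?W h) \<le> card (ends (h s) \<times> V \<union> V \<times> ends (h s))"
      using assms(2) by (intro card_mono) auto
    also have "\<dots> \<le> card (ends (h s) \<times> V) + card (V \<times> ends (h s))" by (rule card_Un_le)
    also have "\<dots> \<le> 2 * card V + card V * 2"
      unfolding card_cartesian_product by (intro add_mono mult_le_mono card_ends order_refl)
    finally show ?thesis using assms(2) by auto
  qed
  have "{f \<in> I \<rightarrow>\<^sub>E V \<times> V. ends (f s) \<inter> ends (f s') \<noteq> {}} =
        {f \<in> I \<rightarrow>\<^sub>E V \<times> V. True \<and> (\<forall>t\<in>{s'}. f t \<in> ?W (restrict f (I - {s'})))}"
    using assms(3-5) by (auto simp: PiE_iff)
  also have "card \<dots> \<le> card (V \<times> V) ^ (card I - card {s'}) * (4 * card V) ^ card {s'}"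
    using assms W by (intro card_PiE_restricted) auto
  finally show ?thesis by (simp add: card_cartesian_product power2_eq_square)
qed

text \<open>Markov's inequality: with \<open>k = card V\<close> and \<open>m = card I\<close> the
  average number of touching pairs is at most \<open>4 * m ^ 2 / k\<close>, and the threshold is
  twice that.\<close>

lemma card_many_touching_pairs:
  assumes "finite I" "I \<noteq> {}" "finite V"
  shows "2 * card {f \<in> I \<rightarrow>\<^sub>E V \<times> V. 8 * card I ^ 2 < card V * card (touching_pairs f I)}
           \<le> (card V ^ 2) ^ card I"
proof -
  let ?\<Omega> = "I \<rightarrow>\<^sub>E V \<times> V" and ?k = "card V" and ?m = "card I"
  let ?B = "{f \<in> ?\<Omega>. 8 * ?m ^ 2 < ?k * card (touching_pairs f I)}"
  let ?D = "{(s, s') \<in> I \<times> I. s \<noteq> s'}"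
  have fin: "finite ?\<Omega>" using assms by (intro finite_PiE) auto
  have finD: "finite ?D" using assms(1) by (auto intro: finite_subset[of _ "I \<times> I"])
  have m: "?m > 0" using assms by (simp add: card_gt_0_iff)
  have "(\<Sum>f\<in>?\<Omega>. card (touching_pairs f I)) =
        (\<Sum>f\<in>?\<Omega>. \<Sum>z\<in>?D. if ends (f (fst z)) \<inter> ends (f (snd z)) \<noteq> {} then 1 else 0)"
  proof (rule sum.cong[OF refl])
    fix f
    have "touching_pairs f I = {z\<in>?D. ends (f (fst z)) \<inter> ends (f (snd z)) \<noteq> {}}"
      by (auto simp: touching_pairs_def)
    then show "card (touching_pairs f I) =
        (\<Sum>z\<in>?D. if ends (f (fst z)) \<inter> ends (f (snd z)) \<noteq> {} then 1 else 0)"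
      using finD by (simp add: sum.If_cases Int_def)
  qed
  also have "\<dots> = (\<Sum>z\<in>?D. card {f\<in>?\<Omega>. ends (f (fst z)) \<inter> ends (f (snd z)) \<noteq> {}})"
    using fin by (subst sum.swap) (simp add: sum.If_cases Int_def)
  also have "\<dots> \<le> (\<Sum>z\<in>?D. (?k ^ 2) ^ (?m - 1) * (4 * ?k))"
    using assms by (intro sum_mono card_touching) auto
  also have "\<dots> = card ?D * ((?k ^ 2) ^ (?m - 1) * (4 * ?k))" by simp
  also have "\<dots> \<le> ?m ^ 2 * ((?k ^ 2) ^ (?m - 1) * (4 * ?k))"
  proof (rule mult_right_mono)
    have "card ?D \<le> card (I \<times> I)" using assms(1) by (intro card_mono) auto
    then show "card ?D \<le> ?m ^ 2" by (simp add: card_cartesian_product power2_eq_square)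
  qed simp
  finally have tot: "(\<Sum>f\<in>?\<Omega>. card (touching_pairs f I)) \<le> ?m ^ 2 * ((?k ^ 2) ^ (?m - 1) * (4 * ?k))" .
  have "card ?B * (8 * ?m ^ 2) = (\<Sum>f\<in>?B. 8 * ?m ^ 2)" by simp
  also have "\<dots> \<le> (\<Sum>f\<in>?B. ?k * card (touching_pairs f I))" by (intro sum_mono) auto
  also have "\<dots> \<le> (\<Sum>f\<in>?\<Omega>. ?k * card (touching_pairs f I))"
    using fin by (intro sum_mono2) auto
  also have "\<dots> = ?k * (\<Sum>f\<in>?\<Omega>. card (touching_pairs f I))" by (simp add: sum_distrib_left)
  also have "\<dots> \<le> ?k * (?m ^ 2 * ((?k ^ 2) ^ (?m - 1) * (4 * ?k)))"
    using tot by (rule mult_left_mono) simp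
  also have "\<dots> = 4 * ?m ^ 2 * ((?k ^ 2) ^ (?m - 1) * ?k ^ 2)" by (simp add: power2_eq_square)
  also have "(?k ^ 2) ^ (?m - 1) * ?k ^ 2 = (?k ^ 2) ^ ?m"
    using m by (metis power_minus_mult)
  finally have "(4 * ?m ^ 2) * (2 * card ?B) \<le> (4 * ?m ^ 2) * (?k ^ 2) ^ ?m" by (simp add: mult_ac)
  then show ?thesis using m by simp
qed

text \<open>Each edge of a path from p over w to q contains exactly one of p and q. The hypothesis
  on \<open>ends (f t)\<close> excludes this, so neither edge of the path can be the one drawn at
  \<open>t\<close>.\<close>

lemma two_path_witnesses:
  assumes "e \<in> two_paths f I" "ends e = ends (f t) \<or> ends e \<inter> ends (f t) = {}"
  shows "\<exists>s\<in>I. \<exists>s'\<in>I. s \<noteq> t \<and> s' \<noteq> t \<and> (\<forall>I'. s \<in> I' \<longrightarrow> s' \<in> I' \<longrightarrow> e \<in> two_paths f I')"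
proof -
  obtain p q s s' w where w: "e = (p, q)" "s \<in> I" "s' \<in> I" "p \<noteq> q" "w \<noteq> p" "w \<noteq> q"
      "ends (f s) = {p, w}" "ends (f s') = {w, q}"
    using assms(1) by (auto simp: two_paths_def)
  have e: "ends e = {p, q}" using w by (simp add: ends_def)
  have "s \<noteq> t" using w(4-8) assms(2) unfolding e by auto
  moreover have "s' \<noteq> t" using w(4-8) assms(2) unfolding e by auto
  moreover have "e \<in> two_paths f I'" if "s \<in> I'" "s' \<in> I'" for I'
    using w that unfolding two_paths_def by blast
  ultimately show ?thesis using w(2,3) by blast
qed

lemma two_paths_cong:
  assumes "\<And>s. s \<in> I \<Longrightarrow> f s = g s"
  shows "two_paths f I = two_paths g I"
  using assms by (simp add: two_paths_def cong: bex_cong)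

lemma touching_pairs_cong:
  assumes "\<And>s. s \<in> I \<Longrightarrow> f s = g s"
  shows "touching_pairs f I = touching_pairs g I"
  using assms by (auto simp: touching_pairs_def)

text \<open>
A hit on a two-edge path is witnessed by two other indices. Passing to a fifth of the hits, the set
\<open>J\<close>, we may assume that all witnesses lie outside \<open>J\<close>; then each value on \<open>J\<close> is confined to a small
set determined by the values outside \<open>J\<close>. The condition on \<open>\<sigma>\<close> excludes that a hit witnesses itself.
\<close>

lemma card_hits_on_two_paths:
  fixes V :: "'v set" and I :: "'i set" and c q :: real
  assumes fin: "finite I" "finite V" and V: "V \<noteq> {}"
    and G: "G \<subseteq> V \<times> V" "0 \<le> c" "c * card V ^ 2 \<le> card G"
    and \<sigma>: "inj_on \<sigma> G" "\<And>e. e \<in> G \<Longrightarrow> ends (\<sigma> e) = ends e \<or> ends (\<sigma> e) \<inter> ends e = {}"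
    and q: "0 < q" "q \<le> 1" "64 * card I ^ 2 \<le> q * card V ^ 3"
  shows "real (card {f \<in> I \<rightarrow>\<^sub>E V \<times> V. card V * card (touching_pairs f I) \<le> 8 * card I ^ 2 \<and>
             (\<forall>t\<in>I. f t \<in> G \<longrightarrow> f t \<in> two_paths f I \<or> \<sigma> (f t) \<in> two_paths f I)})
         \<le> real ((card V ^ 2) ^ card I) *
             (exp (- (c / 4 * card I)) + 2 ^ card I * q powr (c / 20 * card I))"
proof -
  let ?\<Omega> = "I \<rightarrow>\<^sub>E V \<times> V" and ?k = "card V" and ?m = "card I"
  let ?B = "{f \<in> ?\<Omega>. ?k * card (touching_pairs f I) \<le> 8 * ?m ^ 2 \<and>
             (\<forall>t\<in>I. f t \<in> G \<longrightarrow> f t \<in> two_paths f I \<or> \<sigma> (f t) \<in> two_paths f I)}"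
  let ?few = "{f \<in> ?\<Omega>. real (card {t\<in>I. f t \<in> G}) \<le> c / 4 * ?m}"
  define P where "P J h \<longleftrightarrow> ?k * card (touching_pairs h (I - J)) \<le> 8 * ?m ^ 2"
    for J and h :: "'i \<Rightarrow> 'v \<times> 'v"
  define W where "W J h = two_paths h (I - J) \<union> {e\<in>G. \<sigma> e \<in> two_paths h (I - J)}"
    for J and h :: "'i \<Rightarrow> 'v \<times> 'v"
  define F where "F J = {f \<in> ?\<Omega>. P J (restrict f (I - J)) \<and>
      (\<forall>t\<in>J. f t \<in> W J (restrict f (I - J)))}" for J
  \<comment> \<open>More than \<open>c / 4 * ?m\<close> hits, of which a fifth survives the passage
    to \<open>J\<close>.\<close>
  let ?\<J> = "{J. J \<subseteq> I \<and> c / 20 * ?m \<le> card J}"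
  \<comment> \<open>There are at most \<open>8 * ?m ^ 2 div ?k\<close> touching pairs. Each yields
    up to four pairs on two-edge paths, and the \<sigma>-preimages of these at most double the
    count.\<close>
  let ?b = "8 * (8 * ?m ^ 2 div ?k)"
  have k: "?k > 0" using fin V by (simp add: card_gt_0_iff)
  have X: "card (V \<times> V) = ?k ^ 2" by (simp add: card_cartesian_product power2_eq_square)
  have fin\<Omega>: "finite ?\<Omega>" using fin by (intro finite_PiE) auto
  have finJ: "finite ?\<J>" using fin by auto
  have finG: "finite G" using G fin by (meson finite_SigmaI finite_subset)

  have cover: "?B \<subseteq> ?few \<union> (\<Union>J\<in>?\<J>. F J)"
  proof
    fix f assume f: "f \<in> ?B"
    show "f \<in> ?few \<union> (\<Union>J\<in>?\<J>. F J)"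
    proof (cases "f \<in> ?few")
      case False
      define H where "H = {t\<in>I. f t \<in> G}"
      have H: "c / 4 * ?m < card H" using False f by (auto simp: H_def)
      have "\<exists>s s'. s \<noteq> t \<and> s' \<noteq> t \<and> s \<in> I \<and> s' \<in> I \<and>
          (\<forall>I'. s \<in> I' \<longrightarrow> s' \<in> I' \<longrightarrow> f t \<in> two_paths f I' \<or> \<sigma> (f t) \<in> two_paths f I')"
        if "t \<in> H" for t
      proof -
        have t: "t \<in> I" "f t \<in> G" using that by (auto simp: H_def)
        have "f t \<in> two_paths f I \<or> \<sigma> (f t) \<in> two_paths f I" using f t by blast
        then obtain e where e: "e = f t \<or> e = \<sigma> (f t)" "e \<in> two_paths f I" by blast
        have "ends e = ends (f t) \<or> ends e \<inter> ends (f t) = {}" using e(1) \<sigma>(2)[OF t(2)] by blast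
        from two_path_witnesses[OF e(2) this] obtain s s' where s: "s \<noteq> t" "s' \<noteq> t" "s \<in> I" "s' \<in> I"
            "\<And>I'. s \<in> I' \<Longrightarrow> s' \<in> I' \<Longrightarrow> e \<in> two_paths f I'" by blast
        show ?thesis
          using s e(1) by (intro exI[of _ s] exI[of _ s']) metis
      qed
      then obtain a b where ab: "\<And>t. t \<in> H \<Longrightarrow> a t \<noteq> t \<and> b t \<noteq> t \<and> a t \<in> I \<and> b t \<in> I \<and>
          (\<forall>I'. a t \<in> I' \<longrightarrow> b t \<in> I' \<longrightarrow> f t \<in> two_paths f I' \<or> \<sigma> (f t) \<in> two_paths f I')"
        by metis
      have "finite H" using fin by (simp add: H_def)
      then obtain J where J: "J \<subseteq> H" "card H \<le> 5 * card J" "\<forall>t\<in>J. a t \<notin> J \<and> b t \<notin> J"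
        using ex_large_subset_avoiding[of H a b] ab by blast
      have J\<J>: "J \<in> ?\<J>"
      proof -
        have "J \<subseteq> I" using J(1) by (auto simp: H_def)
        moreover have "real (card H) \<le> 5 * real (card J)" using J(2) by linarith
        ultimately show ?thesis using H by auto
      qed
      have tp: "two_paths (restrict f (I - J)) (I - J) = two_paths f (I - J)"
        by (rule two_paths_cong) auto
      have "touching_pairs (restrict f (I - J)) (I - J) = touching_pairs f (I - J)"
        by (rule touching_pairs_cong) auto
      also have "card \<dots> \<le> card (touching_pairs f I)"
        by (intro card_mono finite_touching_pairs fin) (auto simp: touching_pairs_def)
      finally have "?k * card (touching_pairs (restrict f (I - J)) (I - J)) \<le> ?k * card (touching_pairs f I)"
        by (rule mult_left_mono) simp
      also have "\<dots> \<le> 8 * ?m ^ 2" using f by simp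
      finally have "P J (restrict f (I - J))" unfolding P_def .
      moreover have "f t \<in> W J (restrict f (I - J))" if "t \<in> J" for t
      proof -
        have t: "t \<in> H" using that J(1) by auto
        then have "f t \<in> G" by (simp add: H_def)
        moreover have "f t \<in> two_paths f (I - J) \<or> \<sigma> (f t) \<in> two_paths f (I - J)"
          using ab[OF t] J(3) that by blast
        ultimately show ?thesis by (auto simp: W_def tp)
      qed
      ultimately have "f \<in> F J" using f by (auto simp: F_def)
      then show ?thesis using J\<J> by blast
    qed simp
  qed

  have W: "finite (W J h) \<and> card (W J h) \<le> ?b" if "P J h" for J h
  proof -
    let ?T = "two_paths h (I - J)"
    have finT: "finite ?T" "card ?T \<le> 4 * card (touching_pairs h (I - J))"
      using fin by (intro card_two_paths; simp)+
    have "card {e\<in>G. \<sigma> e \<in> ?T} = card (\<sigma> ` {e\<in>G. \<sigma> e \<in> ?T})"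
      using \<sigma>(1) by (subst card_image) (auto intro: inj_on_subset)
    also have "\<dots> \<le> card ?T" by (intro card_mono finT) auto
    finally have "card (W J h) \<le> 2 * card ?T"
      unfolding W_def using card_Un_le[of ?T "{e\<in>G. \<sigma> e \<in> ?T}"] by linarith
    also have "\<dots> \<le> 8 * card (touching_pairs h (I - J))" using finT by simp
    also have "\<dots> \<le> ?b"
      using that k unfolding P_def by (simp add: less_eq_div_iff_mult_less_eq mult.commute)
    finally show ?thesis using finT finG by (simp add: W_def)
  qed
  \<comment> \<open>The last hypothesis on \<open>q\<close> says exactly that a confined value has
    at most a fraction \<open>q\<close> of all pairs to choose from.\<close>
  have b: "real ?b \<le> q * ?k ^ 2"
  proof -
    have "?b * ?k \<le> 64 * ?m ^ 2"
      using div_times_less_eq_dividend[of "8 * ?m ^ 2" ?k] by (simp add: mult.assoc)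
    then have "real ?b * ?k \<le> 64 * ?m ^ 2" by (metis of_nat_le_iff of_nat_mult of_nat_numeral of_nat_power)
    also have "\<dots> \<le> (q * ?k ^ 2) * ?k" using q(3) by (simp add: power2_eq_square power3_eq_cube mult_ac)
    finally show ?thesis using k by simp
  qed
  have FJ: "real (card (F J)) \<le> real ((?k ^ 2) ^ ?m) * q powr (c / 20 * ?m)" if "J \<in> ?\<J>" for J
  proof -
    have Jm: "card J \<le> ?m" using that fin by (auto intro: card_mono)
    have "card (F J) \<le> card (V \<times> V) ^ (?m - card J) * ?b ^ card J"
      unfolding F_def using fin that W by (intro card_PiE_restricted) auto
    then have "real (card (F J)) \<le> real ((?k ^ 2) ^ (?m - card J) * ?b ^ card J)"
      unfolding X by (rule of_nat_mono)
    also have "\<dots> = real (?k ^ 2) ^ (?m - card J) * real ?b ^ card J" by simp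
    also have "\<dots> \<le> real (?k ^ 2) ^ (?m - card J) * (q * ?k ^ 2) ^ card J"
      using b by (intro mult_left_mono power_mono) auto
    also have "\<dots> = real ((?k ^ 2) ^ ?m) * q ^ card J"
      using Jm by (simp add: power_mult_distrib power_add[symmetric])
    also have "q ^ card J = q powr card J" using q by (simp add: powr_realpow)
    also have "\<dots> \<le> q powr (c / 20 * ?m)" using q that by (intro powr_mono') auto
    finally show ?thesis by (simp add: mult_left_mono)
  qed
  have fF: "finite (F J)" for J using fin\<Omega> by (simp add: F_def)
  have "card ?B \<le> card (?few \<union> (\<Union>J\<in>?\<J>. F J))"
    using cover fin\<Omega> finJ fF by (intro card_mono) auto
  also have "\<dots> \<le> card ?few + card (\<Union>J\<in>?\<J>. F J)" by (rule card_Un_le)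
  also have "\<dots> \<le> card ?few + (\<Sum>J\<in>?\<J>. card (F J))"
    using card_UN_le[OF finJ, of F] by simp
  finally have "card ?B \<le> card ?few + (\<Sum>J\<in>?\<J>. card (F J))" .
  then have "real (card ?B) \<le> real (card ?few + (\<Sum>J\<in>?\<J>. card (F J)))" by (rule of_nat_mono)
  also have "\<dots> = real (card ?few) + (\<Sum>J\<in>?\<J>. real (card (F J)))"
    by (simp only: of_nat_add of_nat_sum)
  also have "real (card ?few) \<le> real ((?k ^ 2) ^ ?m) * exp (- (c / 4 * ?m))"
    using card_PiE_few_hits[of I "V \<times> V" G c] fin G by (simp add: X card_cartesian_product power2_eq_square)
  also have "(\<Sum>J\<in>?\<J>. real (card (F J))) \<le> (\<Sum>J\<in>?\<J>. real ((?k ^ 2) ^ ?m) * q powr (c / 20 * ?m))"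
    by (rule sum_mono) (rule FJ)
  \<comment> \<open>The crude union bound over all subsets of \<open>I\<close> produces the factor
    \<open>2 ^ ?m\<close>, to be absorbed later by taking \<open>q\<close> small.\<close>
  also have "\<dots> \<le> (\<Sum>J\<in>Pow I. real ((?k ^ 2) ^ ?m) * q powr (c / 20 * ?m))"
    using fin by (intro sum_mono2) auto
  also have "\<dots> = real ((?k ^ 2) ^ ?m) * (2 ^ ?m * q powr (c / 20 * ?m))"
    using fin by (simp add: card_Pow)
  finally show ?thesis by (simp add: algebra_simps)
qed

section \<open>Clashing pairs of relations\<close>

definition clashing ::
  "nat \<Rightarrow> (nat \<Rightarrow> nat \<Rightarrow> bool) \<Rightarrow> (nat \<Rightarrow> nat \<Rightarrow> bool) \<Rightarrow> real \<Rightarrow> bool" where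
  "clashing g P R \<epsilon> \<longleftrightarrow> (\<forall>A \<chi>. A \<subseteq> {..<g} \<and> inj_on \<chi> A \<and> \<chi> ` A \<subseteq> {..<g} \<and> \<epsilon> * g \<le> card A \<longrightarrow>
     (\<exists>x\<in>A. \<exists>y\<in>A. P x y \<and> R (\<chi> x) (\<chi> y)))"

lemma clashingD:
  assumes "clashing g P R \<epsilon>" "A \<subseteq> {..<g}" "inj_on \<chi> A" "\<chi> ` A \<subseteq> {..<g}" "\<epsilon> * g \<le> card A"
  shows "\<exists>x\<in>A. \<exists>y\<in>A. P x y \<and> R (\<chi> x) (\<chi> y)"
  using assms unfolding clashing_def by blast

text \<open>Apply the hypothesis to the inverse of \<chi> on its image, which has the same
  size.\<close>

lemma clashing_swap:
  assumes "clashing g P R \<epsilon>"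
  shows "clashing g R P \<epsilon>"
  unfolding clashing_def
proof (intro allI impI)
  fix A and \<chi> :: "nat \<Rightarrow> nat"
  assume A: "A \<subseteq> {..<g} \<and> inj_on \<chi> A \<and> \<chi> ` A \<subseteq> {..<g} \<and> \<epsilon> * g \<le> card A"
  have inv: "inj_on (inv_into A \<chi>) (\<chi> ` A)" "inv_into A \<chi> ` (\<chi> ` A) = A" "card (\<chi> ` A) = card A"
    using A by (simp_all add: inj_on_inv_into card_image)
  have "\<exists>x\<in>\<chi> ` A. \<exists>y\<in>\<chi> ` A. P x y \<and> R (inv_into A \<chi> x) (inv_into A \<chi> y)"
    by (rule clashingD[OF assms]) (use A inv in auto)
  then show "\<exists>x\<in>A. \<exists>y\<in>A. R x y \<and> P (\<chi> x) (\<chi> y)"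
    by (metis f_inv_into_f inv_into_into)
qed

section \<open>Passing from g points to the blow-up on k points by residues modulo g\<close>

lemma card_residue_class:
  assumes "0 < g"
  shows "card {x\<in>{..<k}. x mod g = a} \<le> k div g + 1"
proof -
  have "{x\<in>{..<k}. x mod g = a} \<subseteq> (\<lambda>i. a + i * g) ` {..k div g}"
  proof
    fix x assume x: "x \<in> {x\<in>{..<k}. x mod g = a}"
    then have "x = a + (x div g) * g" by (auto simp: mod_div_mult_eq)
    moreover have "x div g \<le> k div g" using x by (intro div_le_mono) auto
    ultimately show "x \<in> (\<lambda>i. a + i * g) ` {..k div g}" by blast
  qed
  then have "card {x\<in>{..<k}. x mod g = a} \<le> card ((\<lambda>i. a + i * g) ` {..k div g})"
    by (intro card_mono) auto
  also have "\<dots> \<le> card {..k div g}" by (rule card_image_le) simp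
  finally show ?thesis by simp
qed

text \<open>An injection on the blow-up induces no map on residues, only a bipartite graph of
  residue pairs \<open>(a, b)\<close> whose cells are large. A matching in this graph is a partial
  injection on residues, to which the clash applies.\<close>

lemma clashing_large_cells:
  fixes g k :: nat and \<epsilon> :: real
  defines "cell \<equiv> \<lambda>A \<chi> a b. {x\<in>A. x mod g = a \<and> \<chi> x mod g = b}"
  assumes clash: "clashing g P R \<epsilon>" and "0 < g" "0 < \<epsilon>" "2 * g < k"
    and A: "A \<subseteq> {..<k}" "inj_on \<chi> A" "\<chi> ` A \<subseteq> {..<k}" "4 * \<epsilon> * k \<le> card A"
  obtains a b a' b' where "P a a'" "R b b'"
    "\<epsilon> / g ^ 2 * k \<le> card (cell A \<chi> a b)" "\<epsilon> / g ^ 2 * k \<le> card (cell A \<chi> a' b')"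
proof -
  \<comment> \<open>An inclusion-maximal matching \<open>M\<close> in the graph \<open>B\<close> of large cells covers all of \<open>B\<close>; were it
     small, \<open>A\<close> would be too small.\<close>
  define B where "B = {(a, b) \<in> {..<g} \<times> {..<g}. \<epsilon> / g ^ 2 * k \<le> card (cell A \<chi> a b)}"
  define \<M> where "\<M> = {M. M \<subseteq> B \<and> inj_on fst M \<and> inj_on snd M}"
  have finB: "finite B" by (rule finite_subset[of _ "{..<g} \<times> {..<g}"]) (auto simp: B_def)
  have finA: "finite A" using A(1) finite_subset by blast
  have "finite \<M>" using finB by (simp add: \<M>_def)
  moreover have "\<M> \<noteq> {}" by (auto simp: \<M>_def)
  ultimately obtain M where M: "M \<in> \<M>" and maximal: "\<And>N. N \<in> \<M> \<Longrightarrow> M \<subseteq> N \<Longrightarrow> M = N"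
    by (meson finite_has_maximal)
  have MB: "M \<subseteq> B" and inj: "inj_on fst M" "inj_on snd M" using M by (auto simp: \<M>_def)
  have finM: "finite M" using MB finB finite_subset by blast
  have cover: "a \<in> fst ` M \<or> b \<in> snd ` M" if "(a, b) \<in> B" for a b
  proof (rule ccontr)
    assume neg: "\<not> ?thesis"
    then have "insert (a, b) M \<in> \<M>" using MB inj that by (auto simp: \<M>_def image_iff)
    then have "M = insert (a, b) M" by (intro maximal) auto
    then have "(a, b) \<in> M" by blast
    then show False using neg by (metis fst_conv image_eqI)
  qed
  \<comment> \<open>Otherwise the light cells contribute at most \<open>\<epsilon> * k\<close>
    points, and the covered rows and the covered columns at most
    \<open>\<epsilon> * k + \<epsilon> * g\<close> each. Since \<open>2 * g < k\<close>, the sum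
    stays below \<open>4 * \<epsilon> * k\<close>.\<close>
  have "\<epsilon> * g \<le> card M"
  proof (rule ccontr)
    assume "\<not> ?thesis"
    then have small: "real (card M) < \<epsilon> * g" by simp
    let ?light = "\<Union>z\<in>{..<g} \<times> {..<g} - B. cell A \<chi> (fst z) (snd z)"
    let ?rows = "\<Union>a\<in>fst ` M. {x\<in>{..<k}. x mod g = a}"
    let ?cols = "\<Union>b\<in>snd ` M. {x\<in>A. \<chi> x mod g = b}"
    have "A \<subseteq> ?light \<union> (?rows \<union> ?cols)"
    proof
      fix x assume x: "x \<in> A"
      show "x \<in> ?light \<union> (?rows \<union> ?cols)"
      proof (cases "(x mod g, \<chi> x mod g) \<in> B")
        case True
        then show ?thesis using cover[OF True] x A(1) by auto
      next
        case False
        then have "(x mod g, \<chi> x mod g) \<in> {..<g} \<times> {..<g} - B" using \<open>0 < g\<close> by simp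
        moreover have "x \<in> cell A \<chi> (x mod g) (\<chi> x mod g)" using x by (simp add: cell_def)
        ultimately show ?thesis by force
      qed
    qed
    then have "card A \<le> card (?light \<union> (?rows \<union> ?cols))"
      using finA finM by (intro card_mono) (auto simp: cell_def)
    also have "\<dots> \<le> card ?light + (card ?rows + card ?cols)"
      by (intro order_trans[OF card_Un_le] add_left_mono card_Un_le)
    finally have le: "real (card A) \<le> card ?light + (real (card ?rows) + card ?cols)" by linarith
    have "real (card ?light) \<le> (\<Sum>z\<in>{..<g} \<times> {..<g} - B. real (card (cell A \<chi> (fst z) (snd z))))"
      using of_nat_mono[OF card_UN_le[of "{..<g} \<times> {..<g} - B" "\<lambda>z. cell A \<chi> (fst z) (snd z)"],
        where 'a = real] by simp
    also have "\<dots> \<le> (\<Sum>z\<in>{..<g} \<times> {..<g} - B. \<epsilon> / g ^ 2 * k)"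
      by (intro sum_mono) (auto simp: B_def)
    also have "\<dots> \<le> (\<Sum>z\<in>{..<g} \<times> {..<g}. \<epsilon> / g ^ 2 * k)"
      using \<open>0 < \<epsilon>\<close> by (intro sum_mono2) auto
    also have "\<dots> = \<epsilon> * k" using \<open>0 < g\<close> by (simp add: power2_eq_square)
    finally have light: "real (card ?light) \<le> \<epsilon> * k" .
    have residue: "real (card M * (k div g + 1)) \<le> card M * (k / g + 1)"
      unfolding of_nat_mult using of_nat_div_le_of_nat[of k g] by (intro mult_left_mono) auto
    have "card ?rows \<le> (\<Sum>a\<in>fst ` M. card {x\<in>{..<k}. x mod g = a})"
      using finM by (intro card_UN_le) simp
    also have "\<dots> \<le> (\<Sum>a\<in>fst ` M. k div g + 1)" by (intro sum_mono card_residue_class \<open>0 < g\<close>)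
    also have "\<dots> = card M * (k div g + 1)" using inj by (simp add: card_image)
    finally have "card ?rows \<le> card M * (k div g + 1)" .
    from order_trans[OF of_nat_mono[OF this] residue]
    have "real (card ?rows) \<le> card M * (k / g + 1)" .
    moreover have "card ?cols \<le> (\<Sum>b\<in>snd ` M. card {x\<in>A. \<chi> x mod g = b})"
      using finM by (intro card_UN_le) simp
    moreover have "\<dots> \<le> (\<Sum>b\<in>snd ` M. k div g + 1)"
    proof (intro sum_mono)
      fix b
      have "card {x\<in>A. \<chi> x mod g = b} = card (\<chi> ` {x\<in>A. \<chi> x mod g = b})"
        using A(2) by (subst card_image) (auto intro: inj_on_subset)
      also have "\<dots> \<le> card {x\<in>{..<k}. x mod g = b}" using A(3) by (intro card_mono) auto
      finally show "card {x\<in>A. \<chi> x mod g = b} \<le> k div g + 1"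
        using card_residue_class[OF \<open>0 < g\<close>, of k b] by linarith
    qed
    moreover have "\<dots> = card M * (k div g + 1)" using inj by (simp add: card_image)
    ultimately have rows: "real (card ?rows) \<le> card M * (k / g + 1)"
      and "card ?cols \<le> card M * (k div g + 1)" by linarith+
    from order_trans[OF of_nat_mono[OF this(2)] residue]
    have "real (card ?cols) \<le> card M * (k / g + 1)" .
    moreover note rows
    moreover have "card M * (k / g + 1) \<le> \<epsilon> * g * (k / g + 1)"
      using small by (intro mult_right_mono) auto
    moreover have "\<epsilon> * g * (k / g + 1) = \<epsilon> * k + \<epsilon> * g" using \<open>0 < g\<close> by (simp add: field_simps)
    moreover have "\<epsilon> * (2 * g) < \<epsilon> * k" using \<open>2 * g < k\<close> \<open>0 < \<epsilon>\<close> by simp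
    ultimately show False using le light A(4) by simp
  qed
  \<comment> \<open>The matching read as a function from first to second coordinates.\<close>
  moreover define \<psi> where "\<psi> = snd \<circ> inv_into M fst"
  have \<psi>: "\<psi> a = b" if "(a, b) \<in> M" for a b
    using inv_into_f_f[OF inj(1) that] by (simp add: \<psi>_def)
  have "inj_on \<psi> (fst ` M)"
    unfolding \<psi>_def using inj by (intro comp_inj_on inj_on_inv_into) auto
  moreover have "fst ` M \<subseteq> {..<g}" "\<psi> ` (fst ` M) \<subseteq> {..<g}"
    using MB by (auto simp: B_def \<psi>)
  ultimately have "\<exists>a\<in>fst ` M. \<exists>a'\<in>fst ` M. P a a' \<and> R (\<psi> a) (\<psi> a')"
    using inj(1) by (intro clashingD[OF clash]) (auto simp: card_image)
  then obtain a a' where "a \<in> fst ` M" "a' \<in> fst ` M" and PR: "P a a'" "R (\<psi> a) (\<psi> a')" by blast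
  then obtain b b' where ab: "(a, b) \<in> M" "(a', b') \<in> M" by auto
  then have "R b b'" using PR(2) \<psi> by simp
  then show ?thesis using that[of a a' b b'] PR(1) ab MB by (auto simp: B_def)
qed

text \<open>All pairs from the product of two large cells clash in the blow-up, which gives
  quadratically many. The condition on \<open>ends\<close> is the one required of \<sigma> in
  \<open>card_hits_on_two_paths\<close>; splitting \<open>A\<close> to obtain it turns the factor 4
  into 8.\<close>

lemma clashing_many_pairs:
  fixes g k :: nat and \<epsilon> :: real
  assumes clash: "clashing g P R \<epsilon>" and "0 < g" "0 < \<epsilon>" "2 * g < k" "4 \<le> (\<epsilon> / g ^ 2) ^ 2 * k"
    and A: "A \<subseteq> {..<k}" "inj_on \<chi> A" "\<chi> ` A \<subseteq> {..<k}" "8 * \<epsilon> * k \<le> card A"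
  obtains D where "D \<subseteq> A \<times> A" "(\<epsilon> / g ^ 2) ^ 2 / 2 * k ^ 2 \<le> card D"
    "\<And>x y. (x, y) \<in> D \<Longrightarrow> P (x mod g) (y mod g) \<and> R (\<chi> x mod g) (\<chi> y mod g) \<and>
       (ends (x, y) = ends (\<chi> x, \<chi> y) \<or> ends (x, y) \<inter> ends (\<chi> x, \<chi> y) = {})"
proof -
  let ?\<eta> = "\<epsilon> / g ^ 2"
  have finA: "finite A" using A(1) finite_subset by blast
  \<comment> \<open>On fixed points every pair equals its image; without fixed points only \<open>2 k\<close> pairs meet
     their image.\<close>
  have "A = {x\<in>A. \<chi> x = x} \<union> {x\<in>A. \<chi> x \<noteq> x}" by blast
  then have "card A \<le> card {x\<in>A. \<chi> x = x} + card {x\<in>A. \<chi> x \<noteq> x}" by (metis card_Un_le)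
  then have "real (card A) \<le> real (card {x\<in>A. \<chi> x = x}) + real (card {x\<in>A. \<chi> x \<noteq> x})"
    by linarith
  then have "4 * \<epsilon> * k \<le> card {x\<in>A. \<chi> x = x} \<or> 4 * \<epsilon> * k \<le> card {x\<in>A. \<chi> x \<noteq> x}"
    using A(4) by linarith
  then obtain A' where A': "A' = {x\<in>A. \<chi> x = x} \<or> A' = {x\<in>A. \<chi> x \<noteq> x}" "4 * \<epsilon> * k \<le> card A'"
    by blast
  have sub: "A' \<subseteq> A" using A' by auto
  have "A' \<subseteq> {..<k}" "inj_on \<chi> A'" "\<chi> ` A' \<subseteq> {..<k}"
    using sub A(1,3) inj_on_subset[OF A(2) sub] by auto
  note clashing_large_cells[OF clash \<open>0 < g\<close> \<open>0 < \<epsilon>\<close> \<open>2 * g < k\<close> this A'(2)]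
  then obtain a b a' b' where PR: "P a a'" "R b b'"
    and X: "?\<eta> * k \<le> card {x\<in>A'. x mod g = a \<and> \<chi> x mod g = b}"
    and Y: "?\<eta> * k \<le> card {x\<in>A'. x mod g = a' \<and> \<chi> x mod g = b'}" by this
  define X where "X = {x\<in>A'. x mod g = a \<and> \<chi> x mod g = b}"
  define Y where "Y = {x\<in>A'. x mod g = a' \<and> \<chi> x mod g = b'}"
  have fin: "finite X" "finite Y" using finA sub by (auto simp: X_def Y_def intro: finite_subset)
  have small: "card X \<le> k" "card Y \<le> k"
    using card_mono[of "{..<k}" X] card_mono[of "{..<k}" Y] sub A(1) by (auto simp: X_def Y_def)
  have "(?\<eta> * k) * (?\<eta> * k) \<le> real (card X) * card Y"
    using X Y \<open>0 < \<epsilon>\<close> by (intro mult_mono) (auto simp: X_def Y_def)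
  then have XY: "?\<eta> ^ 2 * k ^ 2 \<le> card (X \<times> Y)"
    by (simp add: card_cartesian_product power2_eq_square mult_ac)
  define D where "D = {(x, y) \<in> X \<times> Y. ends (x, y) = ends (\<chi> x, \<chi> y) \<or> ends (x, y) \<inter> ends (\<chi> x, \<chi> y) = {}}"
  have "X \<times> Y \<subseteq> D \<union> ((\<lambda>x. (x, \<chi> x)) ` X \<union> (\<lambda>y. (\<chi> y, y)) ` Y)"
    using A'(1) by (auto simp: D_def ends_def X_def Y_def)
  then have "card (X \<times> Y) \<le> card (D \<union> ((\<lambda>x. (x, \<chi> x)) ` X \<union> (\<lambda>y. (\<chi> y, y)) ` Y))"
    using fin by (intro card_mono finite_UnI) (auto simp: D_def intro: finite_subset[of _ "X \<times> Y"])
  also have "\<dots> \<le> card D + (card ((\<lambda>x. (x, \<chi> x)) ` X) + card ((\<lambda>y. (\<chi> y, y)) ` Y))"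
    by (intro order_trans[OF card_Un_le] add_left_mono card_Un_le)
  also have "\<dots> \<le> card D + (k + k)"
    using small fin by (intro add_left_mono add_mono order_trans[OF card_image_le]) auto
  finally have "?\<eta> ^ 2 * k ^ 2 \<le> card D + 2 * real k" using XY by linarith
  \<comment> \<open>Thus the \<open>2 * k\<close> discarded pairs are at most half of the guaranteed
    \<open>?\<eta> ^ 2 * k ^ 2\<close>.\<close>
  moreover have "4 * real k \<le> ?\<eta> ^ 2 * k * k" using assms(5) by (intro mult_right_mono) auto
  ultimately have "?\<eta> ^ 2 / 2 * k ^ 2 \<le> card D" by (simp add: power2_eq_square)
  moreover have "D \<subseteq> A \<times> A" using sub by (auto simp: D_def X_def Y_def)
  ultimately show ?thesis using PR by (intro that[of D]) (auto simp: D_def X_def Y_def)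
qed

section \<open>Random sparsification\<close>

definition rand_edge ::
  "nat \<Rightarrow> (nat \<Rightarrow> nat \<Rightarrow> bool) \<Rightarrow> nat set \<Rightarrow> (nat \<Rightarrow> nat \<times> nat) \<Rightarrow> nat \<Rightarrow> nat \<Rightarrow> bool" where
  "rand_edge g R I f x y \<longleftrightarrow> R (x mod g) (y mod g) \<and> (\<exists>t\<in>I. ends (f t) = {x, y})"

text \<open>All edges of a triangle are deleted, not just one. So whether a drawn edge survives
  depends only on whether its ends are joined by a two-edge path.\<close>

definition rand_graph ::
  "nat \<Rightarrow> (nat \<Rightarrow> nat \<Rightarrow> bool) \<Rightarrow> nat set \<Rightarrow> (nat \<Rightarrow> nat \<times> nat) \<Rightarrow> nat \<Rightarrow> nat \<Rightarrow> bool" where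
  "rand_graph g R I f x y \<longleftrightarrow>
     rand_edge g R I f x y \<and> \<not> (\<exists>w. rand_edge g R I f x w \<and> rand_edge g R I f w y)"

lemma rand_edge_two_paths:
  assumes "\<And>a. \<not> R a a" "x \<noteq> y" "rand_edge g R I f x w" "rand_edge g R I f w y"
  shows "(x, y) \<in> two_paths f I"
  using assms unfolding rand_edge_def two_paths_def by (metis (mono_tags, lifting) case_prodI mem_Collect_eq)

text \<open>The failure bound for one fixed injection. Suppose no clash occurs and
  \<open>(\<chi> x, \<chi> y)\<close> is drawn for a candidate pair \<open>(x, y)\<close>. Either
  that edge was deleted, so a two-edge path joins its ends, or it survived and then \<open>x\<close>
  and \<open>y\<close> must have a common neighbour, so a two-edge path joins them. With \<sigma> as
  the inverse of \<chi> on pairs, this is the event counted in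
  \<open>card_hits_on_two_paths\<close>.\<close>

lemma card_avoiding_maps:
  fixes g k m :: nat and \<epsilon> c q :: real
  defines "c \<equiv> (\<epsilon> / g ^ 2) ^ 2 / 2"
  assumes R: "\<And>a. \<not> R a a"
    and clash: "clashing g P R \<epsilon>" and "0 < g" "0 < \<epsilon>" "2 * g < k" "4 \<le> (\<epsilon> / g ^ 2) ^ 2 * k"
    and A: "A \<subseteq> {..<k}" "inj_on \<chi> A" "\<chi> ` A \<subseteq> {..<k}" "8 * \<epsilon> * k \<le> card A"
    and q: "0 < q" "q \<le> 1" "64 * m ^ 2 \<le> q * k ^ 3"
  shows "real (card {f \<in> {..<m} \<rightarrow>\<^sub>E {..<k} \<times> {..<k}.
            k * card (touching_pairs f {..<m}) \<le> 8 * m ^ 2 \<and>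
            (\<forall>x\<in>A. \<forall>y\<in>A. P (x mod g) (y mod g) \<and>
               \<not> (\<exists>z. rand_graph g R {..<m} f x z \<and> rand_graph g R {..<m} f z y) \<longrightarrow>
               \<not> rand_graph g R {..<m} f (\<chi> x) (\<chi> y))})
         \<le> real ((k ^ 2) ^ m) * (exp (- (c / 4 * m)) + 2 ^ m * q powr (c / 20 * m))"
    (is "real (card ?Z) \<le> _")
proof -
  obtain D where D: "D \<subseteq> A \<times> A" "c * k ^ 2 \<le> card D"
    and DPR: "\<And>x y. (x, y) \<in> D \<Longrightarrow> P (x mod g) (y mod g) \<and> R (\<chi> x mod g) (\<chi> y mod g) \<and>
       (ends (x, y) = ends (\<chi> x, \<chi> y) \<or> ends (x, y) \<inter> ends (\<chi> x, \<chi> y) = {})"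
    using clashing_many_pairs[OF clash \<open>0 < g\<close> \<open>0 < \<epsilon>\<close> \<open>2 * g < k\<close> assms(7) A]
    unfolding c_def by blast
  define G where "G = map_prod \<chi> \<chi> ` D"
  define \<sigma> where "\<sigma> = map_prod (inv_into A \<chi>) (inv_into A \<chi>)"
  have \<sigma>: "\<sigma> (\<chi> x, \<chi> y) = (x, y)" if "x \<in> A" "y \<in> A" for x y
    using that A(2) by (simp add: \<sigma>_def)
  have "inj_on (map_prod \<chi> \<chi>) D"
    by (rule inj_on_subset[OF map_prod_inj_on[OF A(2) A(2)] D(1)])
  then have cardG: "card G = card D" by (simp add: G_def card_image)
  have G: "G \<subseteq> {..<k} \<times> {..<k}" using D(1) A(3) by (auto simp: G_def)
  have "inj_on \<sigma> G"
    unfolding G_def using D(1) by (intro inj_onI) (auto simp: \<sigma> subset_iff)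
  moreover have "ends (\<sigma> e) = ends e \<or> ends (\<sigma> e) \<inter> ends e = {}" if e: "e \<in> G" for e
  proof -
    obtain x y where xy: "(x, y) \<in> D" "e = (\<chi> x, \<chi> y)" using e by (auto simp: G_def)
    then have "\<sigma> e = (x, y)" using \<sigma> D(1) by auto
    then show ?thesis using DPR[OF xy(1)] xy(2) by simp
  qed
  moreover have "0 \<le> c" by (simp add: c_def)
  moreover have "c * card {..<k} ^ 2 \<le> card G" using D(2) cardG by simp
  moreover have "{..<k} \<noteq> {}" using \<open>2 * g < k\<close> by auto
  ultimately have "real (card {f \<in> {..<m} \<rightarrow>\<^sub>E {..<k} \<times> {..<k}.
        card {..<k} * card (touching_pairs f {..<m}) \<le> 8 * card {..<m} ^ 2 \<and>
        (\<forall>t\<in>{..<m}. f t \<in> G \<longrightarrow> f t \<in> two_paths f {..<m} \<or> \<sigma> (f t) \<in> two_paths f {..<m})})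
      \<le> real ((card {..<k} ^ 2) ^ card {..<m}) *
          (exp (- (c / 4 * card {..<m})) + 2 ^ card {..<m} * q powr (c / 20 * card {..<m}))"
    using q G by (intro card_hits_on_two_paths) auto
  then have bound: "real (card {f \<in> {..<m} \<rightarrow>\<^sub>E {..<k} \<times> {..<k}.
        k * card (touching_pairs f {..<m}) \<le> 8 * m ^ 2 \<and>
        (\<forall>t\<in>{..<m}. f t \<in> G \<longrightarrow> f t \<in> two_paths f {..<m} \<or> \<sigma> (f t) \<in> two_paths f {..<m})})
      \<le> real ((k ^ 2) ^ m) * (exp (- (c / 4 * m)) + 2 ^ m * q powr (c / 20 * m))"
    (is "real (card ?Y) \<le> _") by simp
  have "?Z \<subseteq> ?Y"
  proof
    fix f assume f: "f \<in> ?Z"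
    have "f t \<in> two_paths f {..<m} \<or> \<sigma> (f t) \<in> two_paths f {..<m}"
      if t: "t \<in> {..<m}" "f t \<in> G" for t
    proof -
      obtain x y where xy: "(x, y) \<in> D" "f t = (\<chi> x, \<chi> y)" using t(2) by (auto simp: G_def)
      have A: "x \<in> A" "y \<in> A" using xy(1) D(1) by auto
      have PR: "P (x mod g) (y mod g)" "R (\<chi> x mod g) (\<chi> y mod g)" using DPR[OF xy(1)] by auto
      have ne: "\<chi> x \<noteq> \<chi> y" using PR(2) R by metis
      then have "x \<noteq> y" by auto
      have edge: "rand_edge g R {..<m} f (\<chi> x) (\<chi> y)"
        using PR(2) t(1) xy(2) by (auto simp: rand_edge_def ends_def intro!: bexI[of _ t])
      show ?thesis
      proof (cases "rand_graph g R {..<m} f (\<chi> x) (\<chi> y)")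
        case True
        then obtain z where "rand_graph g R {..<m} f x z" "rand_graph g R {..<m} f z y"
          using f A PR(1) by blast
        then have "(x, y) \<in> two_paths f {..<m}"
          using rand_edge_two_paths[where R = R, OF R \<open>x \<noteq> y\<close>] by (auto simp: rand_graph_def)
        then show ?thesis using \<sigma>[OF A] xy(2) by simp
      next
        case False
        then obtain w where "rand_edge g R {..<m} f (\<chi> x) w" "rand_edge g R {..<m} f w (\<chi> y)"
          using edge by (auto simp: rand_graph_def)
        then have "(\<chi> x, \<chi> y) \<in> two_paths f {..<m}" using rand_edge_two_paths[where R = R, OF R ne] by auto
        then show ?thesis using xy(2) by simp
      qed
    qed
    then show "f \<in> ?Y" using f by auto
  qed
  moreover have "finite ?Y" by (rule finite_subset[of _ "{..<m} \<rightarrow>\<^sub>E {..<k} \<times> {..<k}"])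
      (auto intro!: finite_PiE)
  ultimately have "card ?Z \<le> card ?Y" by (intro card_mono)
  then show ?thesis using bound by linarith
qed

text \<open>The choice of \<open>q\<close> turns its power into \<open>exp (- ((1 + c) * m))\<close>
  with \<open>m = j * k\<close>, which beats \<open>2 ^ m\<close>. The choice of \<open>j\<close>
  makes \<open>c / 4 * m\<close> at least \<open>(ln k + 4) * k\<close>, which beats the
  \<open>2 ^ k * k ^ k\<close> choices of a set and a map. What remains is
  \<open>2 * exp (- (3 * k))\<close>.\<close>

lemma union_bound_small:
  fixes c q :: real and j k :: nat
  assumes "0 < c" "q = exp (- (20 * (1 + c) / c))" "4 / c * (ln k + 4) \<le> j" "1 \<le> k"
  shows "2 ^ k * real k ^ k * (exp (- (c / 4 * (j * k))) + 2 ^ (j * k) * q powr (c / 20 * (j * k))) < 1 / 2"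
proof -
  let ?m = "real (j * k)"
  have "q powr (c / 20 * ?m) = exp (- ((1 + c) * ?m))"
    using assms(1) by (simp add: assms(2) powr_def field_simps)
  also have "\<dots> = exp (- ?m) * exp (- (c * ?m))"
    by (simp add: exp_add[symmetric] algebra_simps)
  finally have qm: "q powr (c / 20 * ?m) = exp (- ?m) * exp (- (c * ?m))" .
  have "(2::real) ^ (j * k) \<le> exp 1 ^ (j * k)"
    using exp_ge_add_one_self[of 1] by (intro power_mono) auto
  also have "\<dots> = exp ?m" by (simp add: exp_of_nat_mult[symmetric])
  finally have "2 ^ (j * k) * q powr (c / 20 * ?m) \<le> exp ?m * (exp (- ?m) * exp (- (c * ?m)))"
    unfolding qm by (intro mult_right_mono) auto
  also have "\<dots> = exp (- (c * ?m))" by (simp add: exp_add[symmetric])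
  also have "\<dots> \<le> exp (- (c / 4 * ?m))" using assms(1) by simp
  finally have s: "exp (- (c / 4 * ?m)) + 2 ^ (j * k) * q powr (c / 20 * ?m) \<le> 2 * exp (- (c / 4 * ?m))"
    by simp
  have "ln k + 4 \<le> c / 4 * j" using assms(1,3) by (simp add: field_simps)
  then have "(ln k + 4) * k \<le> c / 4 * j * k" by (intro mult_right_mono) auto
  then have e: "exp (- (c / 4 * ?m)) \<le> exp (- ((ln k + 4) * k))" by simp
  have "(2::real) ^ k \<le> exp 1 ^ k"
    using exp_ge_add_one_self[of 1] by (intro power_mono) auto
  also have "\<dots> = exp k" by (simp add: exp_of_nat_mult[symmetric])
  finally have two: "(2::real) ^ k \<le> exp k" .
  have "real k ^ k = exp (ln k * k)"
    using assms(4) by (simp add: exp_of_nat2_mult)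
  then have "2 ^ k * real k ^ k \<le> exp k * exp (ln k * k)" using two by (simp add: mult_right_mono)
  then have "2 ^ k * real k ^ k * (exp (- (c / 4 * ?m)) + 2 ^ (j * k) * q powr (c / 20 * ?m))
      \<le> exp k * exp (ln k * k) * (2 * exp (- ((ln k + 4) * k)))"
    by (rule mult_mono[OF _ order_trans[OF s mult_left_mono[OF e]]]) auto
  also have "\<dots> = 2 * exp (- (3 * real k))" by (simp add: exp_add[symmetric] algebra_simps)
  also have "\<dots> \<le> 2 * exp (- 3)" using assms(4) by simp
  also have "exp (- 3 :: real) = exp (- 1) ^ 3" by (simp add: exp_of_nat_mult[symmetric])
  also have "\<dots> \<le> (1 / 2 :: real) ^ 3"
    using exp_ge_add_one_self[of 1] by (intro power_mono) (auto simp: exp_minus field_simps)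
  finally show ?thesis by (simp add: power3_eq_cube)
qed

text \<open>Union bound with \<open>j * k\<close> draws, where \<open>j\<close> is of order log k.
  At most half of the sequences have too many touching pairs; of the others, fewer than half of all
  sequences fail for some pair of a set and an injection, so a good sequence is left.\<close>

lemma clashing_rand_graph:
  fixes g j k :: nat and \<epsilon> c q :: real
  defines "c \<equiv> (\<epsilon> / g ^ 2) ^ 2 / 2" and "q \<equiv> exp (- (20 * (1 + c) / c))"
  assumes R: "\<And>a. \<not> R a a"
    and clash: "clashing g P R \<epsilon>" and g: "0 < g" "0 < \<epsilon>"
    and k: "2 * g < k" "4 \<le> (\<epsilon> / g ^ 2) ^ 2 * k"
    and j: "4 / c * (ln k + 4) \<le> j" "64 * j ^ 2 \<le> q * k"
  shows "\<exists>f. clashing k (\<lambda>x y. P (x mod g) (y mod g) \<and>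
           \<not> (\<exists>z. rand_graph g R {..<j * k} f x z \<and> rand_graph g R {..<j * k} f z y))
           (rand_graph g R {..<j * k} f) (8 * \<epsilon>)"
proof (rule ccontr)
  assume neg: "\<not> ?thesis"
  let ?m = "j * k" and ?V = "{..<k}"
  let ?\<Omega> = "{..<?m} \<rightarrow>\<^sub>E ?V \<times> ?V"
  let ?S = "\<lambda>f. rand_graph g R {..<?m} f"
  let ?bd = "exp (- (c / 4 * ?m)) + 2 ^ ?m * q powr (c / 20 * ?m)"
  define viol where "viol A \<chi> f \<longleftrightarrow> (\<forall>x\<in>A. \<forall>y\<in>A. P (x mod g) (y mod g) \<and>
      \<not> (\<exists>z. ?S f x z \<and> ?S f z y) \<longrightarrow> \<not> ?S f (\<chi> x) (\<chi> y))" for A and \<chi> :: "nat \<Rightarrow> nat" and f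
  define Z where "Z A \<chi> = {f \<in> ?\<Omega>. k * card (touching_pairs f {..<?m}) \<le> 8 * ?m ^ 2 \<and> viol A \<chi> f}"
    for A and \<chi> :: "nat \<Rightarrow> nat"
  define C where "C = {(A, \<chi>). A \<subseteq> ?V \<and> \<chi> \<in> ?V \<rightarrow>\<^sub>E ?V \<and> inj_on \<chi> A \<and> 8 * \<epsilon> * k \<le> card A}"
  let ?many = "{f \<in> ?\<Omega>. 8 * ?m ^ 2 < k * card (touching_pairs f {..<?m})}"
  have c: "0 < c" using g by (simp add: c_def)
  have k0: "1 \<le> k" using k(1) by simp
  have q: "0 < q" "q \<le> 1" using c by (auto simp: q_def)
  \<comment> \<open>With \<open>j * k\<close> draws the smallness condition of the path count
    becomes \<open>64 * j ^ 2 \<le> q * k\<close>.\<close>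
  have "64 * real j ^ 2 * k ^ 2 \<le> q * k * k ^ 2" using j(2) by (intro mult_right_mono) auto
  then have qm: "64 * ?m ^ 2 \<le> q * k ^ 3"
    by (simp add: power_mult_distrib power2_eq_square power3_eq_cube mult_ac)
  have jpos: "0 < j"
  proof -
    have "0 < 4 / c * (ln k + 4)" using c k0 by (intro mult_pos_pos divide_pos_pos add_nonneg_pos) auto
    then show ?thesis using j(1) by (metis gr0I leD of_nat_0)
  qed
  have CV: "C \<subseteq> Pow ?V \<times> (?V \<rightarrow>\<^sub>E ?V)" by (auto simp: C_def)
  have finPV: "finite (Pow ?V \<times> (?V \<rightarrow>\<^sub>E ?V))" by (auto intro!: finite_PiE)
  have finC: "finite C" using CV finPV by (rule finite_subset)
  have fin\<Omega>: "finite ?\<Omega>" by (intro finite_PiE) auto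
  have card\<Omega>: "card ?\<Omega> = (k ^ 2) ^ ?m"
    by (simp add: card_PiE card_cartesian_product power2_eq_square)

  have "?\<Omega> \<subseteq> ?many \<union> (\<Union>z\<in>C. Z (fst z) (snd z))"
  proof
    fix f assume f: "f \<in> ?\<Omega>"
    have "\<not> clashing k (\<lambda>x y. P (x mod g) (y mod g) \<and> \<not> (\<exists>z. ?S f x z \<and> ?S f z y)) (?S f) (8 * \<epsilon>)"
      using neg by blast
    then obtain A \<chi> where A: "A \<subseteq> ?V" "inj_on \<chi> A" "\<chi> ` A \<subseteq> ?V" "8 * \<epsilon> * k \<le> card A"
      and "\<not> (\<exists>x\<in>A. \<exists>y\<in>A. (P (x mod g) (y mod g) \<and> \<not> (\<exists>z. ?S f x z \<and> ?S f z y)) \<and> ?S f (\<chi> x) (\<chi> y))"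
      unfolding clashing_def by (simp only: not_all not_imp) (elim exE conjE)
    then have v: "viol A \<chi> f" unfolding viol_def by blast
    \<comment> \<open>Only the values on \<open>A\<close> matter. Normalising the map elsewhere
      places it in a finite function space, over which the union bound can run.\<close>
    define \<chi>' where "\<chi>' = (\<lambda>x\<in>?V. if x \<in> A then \<chi> x else x)"
    have \<chi>': "\<chi>' x = \<chi> x" if "x \<in> A" for x using that A(1) by (auto simp: \<chi>'_def)
    have "\<chi>' \<in> ?V \<rightarrow>\<^sub>E ?V" using A(3) by (auto simp: \<chi>'_def image_subset_iff)
    moreover have "inj_on \<chi>' A" using A(2) \<chi>' by (simp add: inj_on_def)
    ultimately have "(A, \<chi>') \<in> C" using A by (simp add: C_def)
    moreover have "viol A \<chi>' f" using v unfolding viol_def by (simp add: \<chi>')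
    ultimately show "f \<in> ?many \<union> (\<Union>z\<in>C. Z (fst z) (snd z))"
      using f by (force simp: Z_def)
  qed
  then have "card ?\<Omega> \<le> card (?many \<union> (\<Union>z\<in>C. Z (fst z) (snd z)))"
    using fin\<Omega> finC by (intro card_mono) (auto simp: Z_def)
  also have "\<dots> \<le> card ?many + card (\<Union>z\<in>C. Z (fst z) (snd z))" by (rule card_Un_le)
  also have "\<dots> \<le> card ?many + (\<Sum>z\<in>C. card (Z (fst z) (snd z)))"
    by (intro add_left_mono card_UN_le finC)
  finally have "real (card ?\<Omega>) \<le> real (card ?many + (\<Sum>z\<in>C. card (Z (fst z) (snd z))))"
    by (rule of_nat_mono)
  also have "\<dots> = real (card ?many) + (\<Sum>z\<in>C. real (card (Z (fst z) (snd z))))"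
    by (simp only: of_nat_add of_nat_sum)
  also have "(\<Sum>z\<in>C. real (card (Z (fst z) (snd z)))) \<le> (\<Sum>z\<in>C. real ((k ^ 2) ^ ?m) * ?bd)"
  proof (intro sum_mono)
    fix z assume "z \<in> C"
    then obtain A \<chi> where z: "z = (A, \<chi>)" "A \<subseteq> ?V" "inj_on \<chi> A" "\<chi> \<in> ?V \<rightarrow>\<^sub>E ?V" "8 * \<epsilon> * k \<le> card A"
      by (auto simp: C_def)
    then have "\<chi> ` A \<subseteq> ?V" by auto
    then show "real (card (Z (fst z) (snd z))) \<le> real ((k ^ 2) ^ ?m) * ?bd"
      using card_avoiding_maps[where R = R, OF R clash g k z(2,3) _ z(5) q qm]
      by (simp add: z(1) Z_def viol_def c_def)
  qed
  also have "\<dots> = card C * (real ((k ^ 2) ^ ?m) * ?bd)" by simp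
  also have "\<dots> \<le> (2 ^ k * real k ^ k) * (real ((k ^ 2) ^ ?m) * ?bd)"
  proof (rule mult_right_mono)
    have "card C \<le> card (Pow ?V \<times> (?V \<rightarrow>\<^sub>E ?V))" by (rule card_mono[OF finPV CV])
    also have "\<dots> = 2 ^ k * k ^ k" by (simp add: card_cartesian_product card_Pow card_PiE)
    finally have "real (card C) \<le> real (2 ^ k * k ^ k)" by (rule of_nat_mono)
    then show "real (card C) \<le> 2 ^ k * real k ^ k" by simp
  qed simp
  also have "\<dots> = real ((k ^ 2) ^ ?m) * (2 ^ k * real k ^ k * ?bd)" by (simp only: mult_ac)
  also have "real (card ?many) \<le> real ((k ^ 2) ^ ?m) * (1 / 2)"
  proof -
    have "2 * card {f \<in> ?\<Omega>. 8 * card {..<?m} ^ 2 < card ?V * card (touching_pairs f {..<?m})}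
        \<le> (card ?V ^ 2) ^ card {..<?m}"
      using jpos k0 by (intro card_many_touching_pairs) (auto simp: lessThan_empty_iff)
    then have "2 * card ?many \<le> (k ^ 2) ^ ?m" by simp
    from of_nat_mono[OF this, where 'a = real] show ?thesis by simp
  qed
  finally have "real ((k ^ 2) ^ ?m) \<le> real ((k ^ 2) ^ ?m) * (1 / 2 + 2 ^ k * real k ^ k * ?bd)"
    unfolding card\<Omega> by (simp add: algebra_simps)
  moreover have "1 / 2 + 2 ^ k * real k ^ k * ?bd < 1"
    using union_bound_small[OF c _ j(1) k0, of q] by (simp add: q_def)
  moreover have "0 < real ((k ^ 2) ^ ?m)" using k0 by simp
  ultimately show False
    by (smt (verit) mult_less_cancel_left2)
qed

section \<open>The sparsification step in a form that can be iterated\<close>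

definition sparsification ::
  "nat \<Rightarrow> (nat \<Rightarrow> nat \<Rightarrow> bool) \<Rightarrow> (nat \<Rightarrow> nat \<Rightarrow> bool) \<Rightarrow> real \<Rightarrow> nat \<Rightarrow> (nat \<Rightarrow> nat \<Rightarrow> bool) \<Rightarrow> bool" where
  "sparsification g P R \<epsilon> k S \<longleftrightarrow>
     (\<forall>x y. S x y \<longrightarrow> S y x) \<and> (\<forall>x y. S x y \<longrightarrow> R (x mod g) (y mod g)) \<and>
     (\<forall>x y z. \<not> (S x y \<and> S y z \<and> S x z)) \<and>
     clashing k (\<lambda>x y. P (x mod g) (y mod g) \<and> \<not> (\<exists>z. S x z \<and> S z y)) S (8 * \<epsilon>)"

lemma sparsificationD:
  assumes "sparsification g P R \<epsilon> k S"
  shows "S x y \<Longrightarrow> S y x" "S x y \<Longrightarrow> R (x mod g) (y mod g)" "\<not> (S x y \<and> S y z \<and> S x z)"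
    and "clashing k (\<lambda>x y. P (x mod g) (y mod g) \<and> \<not> (\<exists>z. S x z \<and> S z y)) S (8 * \<epsilon>)"
proof -
  show "S x y \<Longrightarrow> S y x"
    using assms unfolding sparsification_def by meson
  show "S x y \<Longrightarrow> R (x mod g) (y mod g)"
    using assms unfolding sparsification_def by meson
  show "\<not> (S x y \<and> S y z \<and> S x z)"
    using assms unfolding sparsification_def by meson
  show "clashing k (\<lambda>x y. P (x mod g) (y mod g) \<and> \<not> (\<exists>z. S x z \<and> S z y)) S (8 * \<epsilon>)"
    using assms unfolding sparsification_def by (elim conjE)
qed

lemma ex_sparsification:
  fixes g :: nat and \<epsilon> :: real
  assumes R: "\<And>a. \<not> R a a" "\<And>a b. R a b \<Longrightarrow> R b a"
    and clash: "clashing g P R \<epsilon>" and g: "0 < g" "0 < \<epsilon>"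
  shows "\<exists>K. \<forall>k\<ge>K. \<exists>S. sparsification g P R \<epsilon> k S"
proof -
  define \<eta> where "\<eta> = (\<epsilon> / g ^ 2) ^ 2"
  define c where "c = \<eta> / 2"
  define q where "q = exp (- (20 * (1 + c) / c))"
  have pos: "0 < \<eta>" "0 < c" "0 < q" using g by (auto simp: \<eta>_def c_def q_def)
  have "\<forall>\<^sub>F k in sequentially. 2 * g < k"
    by (rule eventually_gt_at_top)
  moreover have "\<forall>\<^sub>F k in sequentially. 4 \<le> \<eta> * real k"
    using pos by real_asymp
  \<comment> \<open>The summand 1 pays for the ceiling in the later choice of \<open>j\<close>. A
    squared logarithm is eventually below any positive multiple of k.\<close>
  moreover have "\<forall>\<^sub>F k in sequentially. 64 * (4 / c * (ln (real k) + 4) + 1) ^ 2 \<le> q * real k"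
    using pos by real_asymp
  ultimately have "\<forall>\<^sub>F k in sequentially. 2 * g < k \<and> 4 \<le> \<eta> * real k \<and>
      64 * (4 / c * (ln (real k) + 4) + 1) ^ 2 \<le> q * real k"
    by eventually_elim auto
  then obtain K where K: "\<And>k. k \<ge> K \<Longrightarrow> 2 * g < k \<and> 4 \<le> \<eta> * real k \<and>
      64 * (4 / c * (ln (real k) + 4) + 1) ^ 2 \<le> q * real k"
    by (auto simp: eventually_sequentially)
  show ?thesis
  proof (intro exI[of _ K] allI impI)
    fix k assume "K \<le> k"
    note k = K[OF this]
    define j where "j = nat \<lceil>4 / c * (ln (real k) + 4)\<rceil>"
    have nonneg: "0 \<le> 4 / c * (ln (real k) + 4)"
      using pos k by (intro mult_nonneg_nonneg add_nonneg_nonneg) auto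
    have j1: "4 / c * (ln (real k) + 4) \<le> j" unfolding j_def by linarith
    have "real j \<le> 4 / c * (ln (real k) + 4) + 1" using nonneg unfolding j_def by linarith
    then have "real j ^ 2 \<le> (4 / c * (ln (real k) + 4) + 1) ^ 2" by (intro power_mono) auto
    then have j2: "64 * real j ^ 2 \<le> q * k" using k by linarith
    obtain f where f: "clashing k (\<lambda>x y. P (x mod g) (y mod g) \<and>
           \<not> (\<exists>z. rand_graph g R {..<j * k} f x z \<and> rand_graph g R {..<j * k} f z y))
           (rand_graph g R {..<j * k} f) (8 * \<epsilon>)"
      using clashing_rand_graph[of R g P \<epsilon> k j] R(1) clash g k j1 j2
      unfolding \<eta>_def c_def q_def by auto
    have sym: "rand_edge g R {..<j * k} f x y \<Longrightarrow> rand_edge g R {..<j * k} f y x" for x y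
      using R(2) by (auto simp: rand_edge_def insert_commute)
    let ?S = "rand_graph g R {..<j * k} f"
    show "\<exists>S. sparsification g P R \<epsilon> k S"
      unfolding sparsification_def
    proof (intro exI[of _ ?S] conjI allI impI)
      show "?S y x" if "?S x y" for x y using that sym unfolding rand_graph_def by blast
      show "R (x mod g) (y mod g)" if "?S x y" for x y
        using that by (simp add: rand_graph_def rand_edge_def)
      show "\<not> (?S x y \<and> ?S y z \<and> ?S x z)" for x y z unfolding rand_graph_def by blast
    qed (rule f)
  qed
qed

section \<open>Complements of triangle-free graphs and the final construction\<close>

lemma independence_number_co_triangle_free:
  assumes "finite V" "\<And>x y. x \<in> V \<Longrightarrow> y \<in> V \<Longrightarrow> x \<noteq> y \<Longrightarrow> \<not> E x y \<Longrightarrow> H x y"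
    and tf: "\<And>x y z. \<not> (H x y \<and> H y z \<and> H x z)"
  shows "independence_number V E \<le> 2"
  unfolding independence_number_def
proof (subst Max_le_iff)
  show "finite (card ` {S. independent_set V E S})"
    using assms(1) by (auto intro!: finite_imageI finite_subset[of _ "Pow V"] simp: independent_set_def)
  show "card ` {S. independent_set V E S} \<noteq> {}"
    by (auto simp: independent_set_def)
  show "\<forall>a\<in>card ` {S. independent_set V E S}. a \<le> 2"
  proof (intro ballI)
    fix a assume "a \<in> card ` {S. independent_set V E S}"
    then obtain S where S: "independent_set V E S" "a = card S" by auto
    show "a \<le> 2"
    proof (rule ccontr)
      assume "\<not> a \<le> 2"
      then have "3 \<le> card S" using S(2) by simp
      then obtain T where "T \<subseteq> S" "card T = 3" by (meson obtain_subset_with_card_n)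
      then obtain x y z where "x \<in> S" "y \<in> S" "z \<in> S" "x \<noteq> y" "y \<noteq> z" "x \<noteq> z"
        by (auto simp: card_3_iff)
      then show False
        using S(1) assms(2) tf[of x y z] unfolding independent_set_def by (meson subsetD)
    qed
  qed
qed

theorem theorem3p1:
  fixes \<epsilon> :: real
  assumes "\<epsilon> > 0"
  shows "\<exists>N. \<forall>n\<ge>N. \<exists>E :: nat \<Rightarrow> nat \<Rightarrow> bool.
           simple_graph {..<n} E \<and> independence_number {..<n} E \<le> 2 \<and>
           \<not> (\<exists>s u v. real s \<ge> \<epsilon> * real n \<and> odd_connected_pairing {..<n} E s u v)"
proof -
  \<comment> \<open>Each of the three sparsifications multiplies the threshold by 8.\<close>
  define \<delta> where "\<delta> = \<epsilon> / 512"
  have \<delta>: "0 < \<delta>" using assms by (simp add: \<delta>_def)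
  \<comment> \<open>Then \<open>\<delta> * g\<close> exceeds 2, so every admissible set has two
    distinct points, and an injection keeps them distinct.\<close>
  obtain g :: nat where g: "2 / \<delta> < g" using reals_Archimedean2 by blast
  have "0 < 2 / \<delta>" using \<delta> by simp
  then have g0: "0 < g" using g by (metis less_trans of_nat_0_less_iff)
  have "2 < \<delta> * g" using g \<delta> by (simp add: field_simps)
  have start: "clashing g (\<lambda>x y. x \<noteq> y) (\<lambda>x y. x \<noteq> y) \<delta>"
    unfolding clashing_def
  proof (intro allI impI)
    fix A and \<chi> :: "nat \<Rightarrow> nat"
    assume A: "A \<subseteq> {..<g} \<and> inj_on \<chi> A \<and> \<chi> ` A \<subseteq> {..<g} \<and> \<delta> * g \<le> card A"
    then have "2 \<le> card A" using \<open>2 < \<delta> * g\<close> by linarith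
    then obtain T where "T \<subseteq> A" "card T = 2" by (meson obtain_subset_with_card_n)
    then obtain x y where "x \<in> A" "y \<in> A" "x \<noteq> y" by (auto simp: card_2_iff)
    then show "\<exists>x\<in>A. \<exists>y\<in>A. x \<noteq> y \<and> \<chi> x \<noteq> \<chi> y" using A by (metis inj_on_eq_iff)
  qed

  have "\<exists>K. \<forall>k\<ge>K. \<exists>S. sparsification g (\<noteq>) (\<noteq>) \<delta> k S"
    by (rule ex_sparsification[OF _ _ start g0 \<delta>]) auto
  \<comment> \<open>The first two sparsifications are needed at one fixed positive size only, for
    instance \<open>Suc K\<close>; the last one must work for every large \<open>n\<close>.\<close>
  then obtain g\<^sub>1 \<Delta> where g1: "0 < g\<^sub>1" and \<Delta>: "sparsification g (\<noteq>) (\<noteq>) \<delta> g\<^sub>1 \<Delta>"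
    by (metis le_SucI order_refl zero_less_Suc)
  define D where "D = (\<lambda>x y. x mod g \<noteq> y mod g \<and> \<not> (\<exists>z. \<Delta> x z \<and> \<Delta> z y))"
  note \<Delta>_sym = sparsificationD(1)[OF \<Delta>]
  have \<Delta>_irrefl: "\<not> \<Delta> x x" for x using sparsificationD(2)[OF \<Delta>, of x x] by blast
  have "clashing g\<^sub>1 D \<Delta> (8 * \<delta>)" unfolding D_def by (rule sparsificationD(4)[OF \<Delta>])
  \<comment> \<open>The second relation is the one replaced by a random graph. Swapping makes this
    \<open>D\<close>, while \<Delta> is merely blown up.\<close>
  then have clash1: "clashing g\<^sub>1 \<Delta> D (8 * \<delta>)" by (rule clashing_swap)
  have "\<exists>K. \<forall>k\<ge>K. \<exists>S. sparsification g\<^sub>1 \<Delta> D (8 * \<delta>) k S"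
  proof (rule ex_sparsification[OF _ _ clash1 g1])
    show "D b a" if "D a b" for a b using that \<Delta>_sym unfolding D_def by metis
  qed (use \<delta> in \<open>auto simp: D_def\<close>)
  then obtain g\<^sub>2 B where g2: "0 < g\<^sub>2" and B: "sparsification g\<^sub>1 \<Delta> D (8 * \<delta>) g\<^sub>2 B"
    by (metis le_SucI order_refl zero_less_Suc)
  define Q where "Q = (\<lambda>x y. \<Delta> (x mod g\<^sub>1) (y mod g\<^sub>1) \<and> \<not> (\<exists>z. B x z \<and> B z y))"
  note B_sym = sparsificationD(1)[OF B] and B_D = sparsificationD(2)[OF B]
    and B_tf = sparsificationD(3)[OF B]
  have "clashing g\<^sub>2 Q B (64 * \<delta>)" using sparsificationD(4)[OF B] by (simp add: Q_def)
  then have clash2: "clashing g\<^sub>2 B Q (64 * \<delta>)" by (rule clashing_swap)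
  have "\<exists>N. \<forall>n\<ge>N. \<exists>F. sparsification g\<^sub>2 B Q (64 * \<delta>) n F"
  proof (rule ex_sparsification[OF _ _ clash2 g2])
    show "Q b a" if "Q a b" for a b using that \<Delta>_sym B_sym unfolding Q_def by metis
  qed (use \<delta> \<Delta>_irrefl in \<open>auto simp: Q_def\<close>)
  then obtain N where N: "\<And>n. N \<le> n \<Longrightarrow> \<exists>F. sparsification g\<^sub>2 B Q (64 * \<delta>) n F" by blast
  show ?thesis
  proof (intro exI[of _ N] allI impI)
    fix n assume "N \<le> n"
    then obtain F where F: "sparsification g\<^sub>2 B Q (64 * \<delta>) n F" using N by blast
    note F_sym = sparsificationD(1)[OF F] and F_Q = sparsificationD(2)[OF F]
      and F_tf = sparsificationD(3)[OF F]
    have clash: "clashing n (\<lambda>x y. B (x mod g\<^sub>2) (y mod g\<^sub>2) \<and> \<not> (\<exists>z. F x z \<and> F z y)) F \<epsilon>"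
      using sparsificationD(4)[OF F] by (simp add: \<delta>_def)
    define H where "H = (\<lambda>x y. B (x mod g\<^sub>2) (y mod g\<^sub>2) \<or> F x y)"
    have H_sym: "H x y \<Longrightarrow> H y x" for x y using B_sym F_sym by (auto simp: H_def)
    have BBF: "\<not> (B (x mod g\<^sub>2) (y mod g\<^sub>2) \<and> B (y mod g\<^sub>2) (z mod g\<^sub>2) \<and> F x z)" for x y z
      using F_Q unfolding Q_def by blast
    \<comment> \<open>Edges of \<open>F\<close> reach \<Delta> by reducing modulo
      \<open>g\<^sub>2\<close> and then modulo \<open>g\<^sub>1\<close>; the \<open>B\<close>-edge
      lands in \<open>D\<close> on the same residues.\<close>
    have FFB: "\<not> (F x y \<and> F y z \<and> B (x mod g\<^sub>2) (z mod g\<^sub>2))" for x y z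
      using F_Q B_D unfolding Q_def D_def by blast
    have tf: "\<not> (H x y \<and> H y z \<and> H x z)" for x y z
      using BBF FFB B_sym B_tf F_sym F_tf unfolding H_def by meson
    define E where "E = (\<lambda>x y. x < n \<and> y < n \<and> x \<noteq> y \<and> \<not> H x y)"
    have "simple_graph {..<n} E" using H_sym by (auto simp: simple_graph_def E_def)
    moreover have "independence_number {..<n} E \<le> 2"
      by (rule independence_number_co_triangle_free[of _ _ H]) (use tf in \<open>auto simp: E_def\<close>)
    moreover have "\<not> odd_connected_pairing {..<n} E s u v" if s: "\<epsilon> * n \<le> s" for s u v
    proof
      assume ocp: "odd_connected_pairing {..<n} E s u v"
      then have u: "u ` {..<s} \<subseteq> {..<n}" "inj_on u {..<s}" and v: "v ` {..<s} \<subseteq> {..<n}" "inj_on v {..<s}"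
        by (auto simp: odd_connected_pairing_def)
      \<comment> \<open>A pairing is an injection sending each \<open>u i\<close> to
        \<open>v i\<close>. A clash for it supplies two indices for which both required edges are
        missing from \<open>E\<close>.\<close>
      define \<chi> where "\<chi> = v \<circ> inv_into {..<s} u"
      have \<chi>: "\<chi> (u i) = v i" if "i < s" for i using that u(2) by (simp add: \<chi>_def)
      have "inj_on \<chi> (u ` {..<s})"
        using v(2) u(2) by (auto simp: inj_on_def \<chi>)
      moreover have "\<chi> ` u ` {..<s} \<subseteq> {..<n}" using v(1) by (auto simp: \<chi>)
      moreover have "\<epsilon> * n \<le> card (u ` {..<s})" using s u(2) by (simp add: card_image)
      ultimately have "\<exists>x\<in>u ` {..<s}. \<exists>y\<in>u ` {..<s}.
          (B (x mod g\<^sub>2) (y mod g\<^sub>2) \<and> \<not> (\<exists>z. F x z \<and> F z y)) \<and> F (\<chi> x) (\<chi> y)"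
        using u(1) by (intro clashingD[OF clash])
      then obtain i k where ik: "i < s" "k < s" "H (u i) (u k)" "H (v i) (v k)" "F (v i) (v k)"
        by (auto simp: \<chi> H_def)
      \<comment> \<open>Triangle-freeness with all three vertices equal says that \<open>F\<close>
        has no loops.\<close>
      then have "i \<noteq> k" using F_tf by metis
      then have "E (u i) (u k) \<or> E (v i) (v k)"
        using ocp ik by (simp add: odd_connected_pairing_def)
      then show False using ik by (simp add: E_def)
    qed
    ultimately show "\<exists>E :: nat \<Rightarrow> nat \<Rightarrow> bool.
           simple_graph {..<n} E \<and> independence_number {..<n} E \<le> 2 \<and>
           \<not> (\<exists>s u v. real s \<ge> \<epsilon> * real n \<and> odd_connected_pairing {..<n} E s u v)"
      by blast
  qed
qed

end
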